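(* For every integer $k$ and every real number $\alpha>0$ there exists $\beta>0$ such that the following holds. Let $H$ be a set of $k$ closed halfspaces in $\mathbb{R}^d$, let $P$ be a monotone property of $H$-convex sets, and let $\mathcal{B}$ be a finite family of $H$-convex sets in $\mathbb{R}^d$ such that at least $\alpha\binom{|\mathcal{B}|}{k}$ of the $k$-tuples (subfamilies of size $k$) of $\mathcal{B}$ are $P$-intersecting. Then there is a $P$-intersecting subfamily $\mathcal{B}'\subseteq\mathcal{B}$ of cardinality at least $\beta|\mathcal{B}|$. For large enough $|\mathcal{B}|$, we can choose $\beta=1-k(1-\alpha)^{1/(k+1)}$.
   Context: Let $H=\{H_1,\dots,H_k\}$ be a set of $k$ closed halfspaces in $\mathbb{R}^d$. An $H$-convex set $B$ in $\mathbb{R}^d$ is an intersection of $k$ halfspaces $H_1^B,\dots,H_k^B$ such that for each $i$ the halfspace $H_i^B$ is a translate of $H_i$. Intersections of nonempty finite families of $H$-convex sets are $H$-convex. A property $P$ of $H$-convex sets (a class of $H$-convex sets) is monotone if $B\in P$ and $B\subseteq C$ imply $C\in P$ for all $H$-convex sets $B,C$. A family of $H$-convex sets is $P$-intersecting if the intersection of its members has property $P$.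
   Formalization: The first claim is proved for families with |B| ≥ k; for 1 ≤ |B| < k the binomial coefficient is 0, the hypothesis is vacuous, and the claim fails for the empty property P (e.g. k = 2, |B| = 1). *)

theory Defs
  imports Complex_Main "Jordan_Normal_Form.Matrix"
begin

text \<open>The space \<open>\<real>\<^sup>d\<close> is \<open>carrier_vec d\<close>, so that the dimension is an ordinary variable and
  constants can be chosen independently of it.\<close>

definition closed_halfspace :: "nat \<Rightarrow> real vec set \<Rightarrow> bool" where
  "closed_halfspace d S \<longleftrightarrow>
     (\<exists>a \<in> carrier_vec d. \<exists>b. a \<noteq> 0\<^sub>v d \<and> S = {x \<in> carrier_vec d. a \<bullet> x \<le> b})"

definition is_translate :: "nat \<Rightarrow> real vec set \<Rightarrow> real vec set \<Rightarrow> bool" where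
  "is_translate d S T \<longleftrightarrow> (\<exists>v \<in> carrier_vec d. T = (\<lambda>x. x + v) ` S)"

text \<open>Intersections are taken inside \<open>\<real>\<^sup>d\<close>; the intersection of the empty family is \<open>\<real>\<^sup>d\<close>.\<close>

definition inter :: "nat \<Rightarrow> ('i \<Rightarrow> real vec set) \<Rightarrow> 'i set \<Rightarrow> real vec set" where
  "inter d B J = {x \<in> carrier_vec d. \<forall>i\<in>J. x \<in> B i}"

definition H_convex :: "nat \<Rightarrow> real vec set set \<Rightarrow> real vec set \<Rightarrow> bool" where
  "H_convex d H B \<longleftrightarrow> (\<exists>T. (\<forall>h\<in>H. is_translate d h (T h)) \<and> B = inter d T H)"

definition monotone_property :: "nat \<Rightarrow> real vec set set \<Rightarrow> real vec set set \<Rightarrow> bool" where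
  "monotone_property d H P \<longleftrightarrow>
     P \<subseteq> {B. H_convex d H B} \<and>
     (\<forall>B C. H_convex d H B \<longrightarrow> H_convex d H C \<longrightarrow> B \<in> P \<longrightarrow> B \<subseteq> C \<longrightarrow> C \<in> P)"

text \<open>A finite family is indexed (so members may repeat), and a subfamily is given by
  its set \<open>J\<close> of indices.\<close>

definition P_intersecting ::
  "nat \<Rightarrow> real vec set set \<Rightarrow> ('i \<Rightarrow> real vec set) \<Rightarrow> 'i set \<Rightarrow> bool" where
  "P_intersecting d P B J \<longleftrightarrow> inter d B J \<in> P"

text \<open>The fractional Helly assertion with constants \<open>\<alpha>\<close> and \<open>\<beta>\<close>, for all families
  \<open>B 0, \<dots>, B (n - 1)\<close> of \<open>n\<close> members.\<close>

definition fractional_Helly :: "nat \<Rightarrow> real \<Rightarrow> real \<Rightarrow> nat \<Rightarrow> bool" where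
  "fractional_Helly k \<alpha> \<beta> n \<longleftrightarrow>
     (\<forall>(d::nat) (H :: real vec set set) (P :: real vec set set) (B :: nat \<Rightarrow> real vec set).
        finite H \<longrightarrow> card H = k \<longrightarrow> (\<forall>h\<in>H. closed_halfspace d h) \<longrightarrow>
        monotone_property d H P \<longrightarrow>
        (\<forall>i<n. H_convex d H (B i)) \<longrightarrow>
        real (card {J. J \<subseteq> {..<n} \<and> card J = k \<and> P_intersecting d P B J})
          \<ge> \<alpha> * real (n choose k) \<longrightarrow>
        (\<exists>J \<subseteq> {..<n}. P_intersecting d P B J \<and> real (card J) \<ge> \<beta> * real n))"

end

theory Submission
  imports Defs "HOL-Library.FuncSet" "HOL-Library.Disjoint_Sets"
begin

text \<open>
  The translates of one halfspace \<open>h\<close> form a chain under inclusion. Each member \<open>B i\<close> of the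
  family is an intersection of translates \<open>T i h\<close>, one for each \<open>h \<in> H\<close>, so a subfamily is
  governed by the \<open>k\<close> smallest translates that occur in it: if for each \<open>h\<close> some member of \<open>J\<close>
  has its translate inside all those of \<open>K\<close>, then \<open>J\<close> being \<open>P\<close>-intersecting makes \<open>K\<close>
  \<open>P\<close>-intersecting (\<open>P_intersecting_dominated\<close>). Both assertions are double counts that rest on
  this domination. Call a \<open>P\<close>-intersecting \<open>k\<close>-tuple good.

  For a positive \<open>\<beta>\<close>, single out one halfspace \<open>h0\<close>. A good \<open>k\<close>-tuple attains its smallest
  translates of the other \<open>k - 1\<close> halfspaces at no more than \<open>k - 1\<close> members, hence within some
  \<open>(k - 1)\<close>-subset \<open>S\<close>, and so it has the form \<open>S \<union> {e}\<close>. The set \<open>F\<close> of all \<open>e\<close> that arise with a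
  given \<open>S\<close> can be added to \<open>S\<close> simultaneously: except for \<open>h0\<close> the smallest translates come from \<open>S\<close>,
  and the one for \<open>h0\<close> comes from \<open>S\<close> or from a single \<open>e \<in> F\<close>, so \<open>S \<union> {e}\<close> dominates \<open>S \<union> F\<close>
  for a suitable \<open>e\<close> (\<open>P_intersecting_extensions\<close>). There are \<open>n choose (k - 1)\<close> sets \<open>S\<close>, so one of
  them has an \<open>F\<close> of at least the average size, and \<open>\<beta> = \<alpha> / k\<close> works for \<open>\<alpha> \<le> 1\<close>
  (\<open>linear_size_subfamily\<close>).

  For the explicit \<open>\<beta>\<close>, go through the halfspaces one by one and each time discard the \<open>m\<close> remaining
  members with the smallest translates. Any \<open>k\<close>-tuple with one member from each discarded class
  dominates what is left. If the \<open>n - k m\<close> members left are not \<open>P\<close>-intersecting, then none of these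
  \<open>m ^ k\<close> tuples is good, so at most \<open>(n choose k) - m ^ k\<close> tuples are
  (\<open>P_intersecting_or_few_good\<close>). Take \<open>m = \<lfloor>\<gamma> n\<rfloor>\<close> with \<open>\<gamma> ^ (k + 1) = 1 - \<alpha>\<close>. For
  \<open>0 < \<gamma> < 1\<close> and large \<open>n\<close>, \<open>m ^ k\<close> is close to \<open>\<gamma> ^ k * n ^ k\<close> and therefore exceeds
  \<open>\<gamma> ^ (k + 1) * n ^ k = (1 - \<alpha>) * n ^ k\<close>, which is too many bad tuples. For \<open>\<alpha> = 1\<close> all
  \<open>k\<close>-tuples are good, and a \<open>k\<close>-tuple that contains a smallest translate of each halfspace
  dominates the whole family (\<open>Helly\<close>).
\<close>

section \<open>Chains of halfspaces\<close>

text \<open>A translate keeps the normal vector, so it is determined by its offset, and the offsets are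
  real numbers.\<close>
lemma translates_of_halfspace_chain:
  assumes "closed_halfspace d h" "is_translate d h S" "is_translate d h T"
  shows "S \<subseteq> T \<or> T \<subseteq> S"
proof -
  obtain a b where a: "a \<in> carrier_vec d" and h: "h = {x \<in> carrier_vec d. a \<bullet> x \<le> b}"
    using assms(1) unfolding closed_halfspace_def by blast
  have "\<exists>c. S' = {x \<in> carrier_vec d. a \<bullet> x \<le> c}" if S'_translate: "is_translate d h S'" for S'
  proof -
    obtain v where v: "v \<in> carrier_vec d" and S': "S' = (\<lambda>x. x + v) ` h"
      using S'_translate unfolding is_translate_def by blast
    have "x \<in> S' \<longleftrightarrow> x \<in> carrier_vec d \<and> a \<bullet> x \<le> b + a \<bullet> v" for x
    proof
      assume "x \<in> S'"
      then show "x \<in> carrier_vec d \<and> a \<bullet> x \<le> b + a \<bullet> v"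
        using a v by (auto simp: S' h scalar_prod_add_distrib[OF a])
    next
      assume x: "x \<in> carrier_vec d \<and> a \<bullet> x \<le> b + a \<bullet> v"
      have "x - v \<in> h"
        using x a v by (auto simp: h scalar_prod_minus_distrib[OF a])
      moreover have "x = (x - v) + v"
        using x v by auto
      ultimately show "x \<in> S'"
        unfolding S' by blast
    qed
    then show ?thesis
      by blast
  qed
  then obtain s t where "S = {x \<in> carrier_vec d. a \<bullet> x \<le> s}" "T = {x \<in> carrier_vec d. a \<bullet> x \<le> t}"
    using assms(2,3) by meson
  then show ?thesis
    by (cases "s \<le> t") auto
qed

lemma chain_least_member:
  fixes f :: "'i \<Rightarrow> 'a set"
  assumes "finite J" "J \<noteq> {}" "\<And>i j. i \<in> J \<Longrightarrow> j \<in> J \<Longrightarrow> f i \<subseteq> f j \<or> f j \<subseteq> f i"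
  obtains i where "i \<in> J" "\<And>j. j \<in> J \<Longrightarrow> f i \<subseteq> f j"
proof -
  have "\<exists>i\<in>J. \<forall>j\<in>J. f i \<subseteq> f j"
    using assms
  proof (induction J rule: finite_ne_induct)
    case (insert x F)
    then obtain i where i: "i \<in> F" "\<forall>j\<in>F. f i \<subseteq> f j"
      by auto
    show ?case
    proof (cases "f i \<subseteq> f x")
      case True
      then show ?thesis using i by blast
    next
      case False
      then have "f x \<subseteq> f i"
        using insert.prems i by blast
      then show ?thesis using i by blast
    qed
  qed auto
  then show ?thesis
    using that by blast
qed

lemma chain_least_members:
  fixes f :: "'i \<Rightarrow> 'a set"
  assumes "finite W" "m \<le> card W"
    and chain: "\<And>i j. i \<in> W \<Longrightarrow> j \<in> W \<Longrightarrow> f i \<subseteq> f j \<or> f j \<subseteq> f i"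
  shows "\<exists>R\<subseteq>W. card R = m \<and> (\<forall>r\<in>R. \<forall>w\<in>W - R. f r \<subseteq> f w)"
  using assms(2)
proof (induction m)
  case 0
  show ?case
    by (intro exI[of _ "{}"]) auto
next
  case (Suc m)
  then obtain R where R: "R \<subseteq> W" "card R = m" "\<And>r w. r \<in> R \<Longrightarrow> w \<in> W - R \<Longrightarrow> f r \<subseteq> f w"
    by auto
  have fin: "finite R"
    using R(1) assms(1) finite_subset by blast
  have "W - R \<noteq> {}"
    using Suc.prems R(2) card_mono[OF fin, of W] by auto
  then obtain i where i: "i \<in> W - R" "\<And>j. j \<in> W - R \<Longrightarrow> f i \<subseteq> f j"
    using chain_least_member[of "W - R" f] assms(1) chain by (metis DiffD1 finite_Diff)
  have "card (insert i R) = Suc m"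
    using fin i(1) R(2) by auto
  then show ?case
    using R i by (intro exI[of _ "insert i R"]) auto
qed

text \<open>Classes are chosen greedily, each from the members that the earlier classes leave over. This
  makes them disjoint; a later choice only shrinks the remainder, so an earlier class still lies
  below it.\<close>
lemma disjoint_least_members:
  fixes f :: "'h \<Rightarrow> 'i \<Rightarrow> 'a set"
  assumes "finite H" "finite W" "card H * m \<le> card W"
    and "\<And>h i j. h \<in> H \<Longrightarrow> i \<in> W \<Longrightarrow> j \<in> W \<Longrightarrow> f h i \<subseteq> f h j \<or> f h j \<subseteq> f h i"
  shows "\<exists>R. (\<forall>h\<in>H. R h \<subseteq> W \<and> card (R h) = m) \<and> disjoint_family_on R H \<and>
             (\<forall>h\<in>H. \<forall>r\<in>R h. \<forall>w\<in>W - \<Union>(R ` H). f h r \<subseteq> f h w)"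
  using assms(1,3,4)
proof (induction H rule: finite_induct)
  case empty
  then show ?case
    by (auto simp: disjoint_family_on_def)
next
  case (insert h F)
  have "card F * m \<le> card W"
    using insert.prems(1) insert.hyps by auto
  then obtain R where R: "\<forall>g\<in>F. R g \<subseteq> W \<and> card (R g) = m" "disjoint_family_on R F"
      "\<forall>g\<in>F. \<forall>r\<in>R g. \<forall>w\<in>W - \<Union>(R ` F). f g r \<subseteq> f g w"
    using insert.IH insert.prems(2) by (metis insertCI)
  let ?W = "W - \<Union>(R ` F)"
  have "card (\<Union>(R ` F)) \<le> card F * m"
    using card_UN_le[OF insert.hyps(1), of R] R(1) by simp
  moreover have "card ?W \<ge> card W - card (\<Union>(R ` F))"
    by (rule diff_card_le_card_Diff) (use R(1) insert.hyps(1) assms(2) in \<open>auto intro: finite_subset\<close>)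
  ultimately have "m \<le> card ?W"
    using insert.prems(1) insert.hyps by auto
  then have "\<exists>Q\<subseteq>?W. card Q = m \<and> (\<forall>r\<in>Q. \<forall>w\<in>?W - Q. f h r \<subseteq> f h w)"
    by (intro chain_least_members) (use assms(2) insert.prems(2) in auto)
  then obtain Q where Q: "Q \<subseteq> ?W" "card Q = m" "\<forall>r\<in>Q. \<forall>w\<in>?W - Q. f h r \<subseteq> f h w"
    by blast
  let ?R = "R(h := Q)"
  have eq: "?R g = R g" if "g \<in> F" for g
    using that insert.hyps by auto
  have un: "\<Union>(?R ` insert h F) = Q \<union> \<Union>(R ` F)"
  proof -
    have "\<Union>(?R ` F) = \<Union>(R ` F)"
      using eq by (intro SUP_cong) auto
    then show ?thesis
      by (simp only: image_insert Union_insert fun_upd_same)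
  qed
  show ?case
  proof (intro exI[of _ ?R] conjI)
    show "\<forall>g\<in>insert h F. ?R g \<subseteq> W \<and> card (?R g) = m"
      using R(1) Q eq by auto
    have "disjoint_family_on ?R F"
      using R(2) eq unfolding disjoint_family_on_def by simp
    moreover have "?R h \<inter> \<Union>(?R ` F) = {}"
      using Q(1) eq by auto
    ultimately show "disjoint_family_on ?R (insert h F)"
      using insert.hyps(2) by (auto simp: disjoint_family_on_insert)
    show "\<forall>g\<in>insert h F. \<forall>r\<in>?R g. \<forall>w\<in>W - \<Union>(?R ` insert h F). f g r \<subseteq> f g w"
      unfolding un
    proof (intro ballI)
      fix g r w assume g: "g \<in> insert h F" and r: "r \<in> ?R g" and w: "w \<in> W - (Q \<union> \<Union>(R ` F))"
      show "f g r \<subseteq> f g w"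
      proof (cases "g = h")
        case True
        moreover have "w \<in> ?W - Q"
          using w by simp
        ultimately show ?thesis
          using Q(3) r by simp
      next
        case False
        moreover have "w \<in> ?W"
          using w by simp
        ultimately show ?thesis
          using R(3) g r by simp
      qed
    qed
  qed
qed

section \<open>Families of H-convex sets\<close>

text \<open>The translates \<open>T i h\<close> that cut out \<open>B i\<close> need not be unique; one choice is fixed.\<close>
locale H_convex_family =
  fixes d :: nat and H P :: "real vec set set" and I :: "'i set"
    and B :: "'i \<Rightarrow> real vec set" and T :: "'i \<Rightarrow> real vec set \<Rightarrow> real vec set"
  assumes finite_H: "finite H"
    and halfspace: "h \<in> H \<Longrightarrow> closed_halfspace d h"
    and monotone: "monotone_property d H P"
    and finite_I: "finite I"
    and translate: "i \<in> I \<Longrightarrow> h \<in> H \<Longrightarrow> is_translate d h (T i h)"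
    and member_eq: "i \<in> I \<Longrightarrow> B i = inter d (T i) H"
begin

definition good :: "'i set set" where
  "good = {J. J \<subseteq> I \<and> card J = card H \<and> P_intersecting d P B J}"

lemma finite_good: "finite good"
  unfolding good_def using finite_I by auto

lemma good_le_choose: "card good \<le> card I choose card H"
proof -
  have "card good \<le> card {J. J \<subseteq> I \<and> card J = card H}"
    by (rule card_mono) (auto simp: good_def finite_I)
  then show ?thesis
    by (simp add: n_subsets finite_I)
qed

lemma least_member:
  assumes "J \<subseteq> I" "J \<noteq> {}" "h \<in> H"
  obtains i where "i \<in> J" "\<And>j. j \<in> J \<Longrightarrow> T i h \<subseteq> T j h"
proof (rule chain_least_member[of J "\<lambda>i. T i h"])
  show "finite J"
    using assms(1) finite_I finite_subset by blast
  show "T i h \<subseteq> T j h \<or> T j h \<subseteq> T i h" if "i \<in> J" "j \<in> J" for i j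
    using translates_of_halfspace_chain[OF halfspace translate translate] assms that by blast
qed (use assms in auto)

lemma inter_eq:
  assumes "J \<subseteq> I"
  shows "inter d B J = {x \<in> carrier_vec d. \<forall>i\<in>J. \<forall>h\<in>H. x \<in> T i h}"
  using assms by (auto simp: inter_def member_eq subset_iff)

text \<open>For each \<open>h\<close> the smallest translate that occurs in \<open>J\<close> already gives the intersection of all
  of them. An empty \<open>J\<close> has no such translate.\<close>
lemma H_convex_inter:
  assumes "J \<subseteq> I" "J \<noteq> {}"
  shows "H_convex d H (inter d B J)"
proof -
  have "\<forall>h\<in>H. \<exists>i\<in>J. \<forall>j\<in>J. T i h \<subseteq> T j h"
    using least_member[OF assms] by metis
  then obtain i where i: "\<And>h. h \<in> H \<Longrightarrow> i h \<in> J" "\<And>h j. h \<in> H \<Longrightarrow> j \<in> J \<Longrightarrow> T (i h) h \<subseteq> T j h"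
    by metis
  have "inter d B J = inter d (\<lambda>h. T (i h) h) H"
  proof (intro equalityI subsetI)
    fix x assume "x \<in> inter d B J"
    then show "x \<in> inter d (\<lambda>h. T (i h) h) H"
      using i(1) unfolding inter_eq[OF assms(1)] by (simp add: inter_def)
  next
    fix x assume x: "x \<in> inter d (\<lambda>h. T (i h) h) H"
    have "x \<in> T j h" if "j \<in> J" "h \<in> H" for j h
      using i(2)[OF that(2,1)] x that(2) by (auto simp: inter_def)
    then show "x \<in> inter d B J"
      using x unfolding inter_eq[OF assms(1)] by (simp add: inter_def)
  qed
  moreover have "\<forall>h\<in>H. is_translate d h (T (i h) h)"
    using i(1) assms(1) translate by blast
  ultimately show ?thesis
    unfolding H_convex_def by (intro exI[of _ "\<lambda>h. T (i h) h"]) simp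
qed

text \<open>The hypothesis puts the intersection over \<open>J\<close> inside the one over \<open>K\<close>, and both are
  \<open>H\<close>-convex, so \<open>P\<close> passes from the first to the second.\<close>
lemma P_intersecting_dominated:
  assumes "P_intersecting d P B J" "J \<subseteq> I" "J \<noteq> {}" "K \<subseteq> I" "K \<noteq> {}"
    and dom: "\<And>h. h \<in> H \<Longrightarrow> \<exists>j\<in>J. \<forall>i\<in>K. T j h \<subseteq> T i h"
  shows "P_intersecting d P B K"
proof -
  have "inter d B J \<subseteq> inter d B K"
    unfolding inter_eq[OF assms(2)] inter_eq[OF assms(4)] using dom by blast
  moreover have "H_convex d H (inter d B J)" "H_convex d H (inter d B K)"
    using H_convex_inter assms(2-5) by auto
  moreover have "\<forall>B C. H_convex d H B \<longrightarrow> H_convex d H C \<longrightarrow> B \<in> P \<longrightarrow> B \<subseteq> C \<longrightarrow> C \<in> P"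
    using monotone unfolding monotone_property_def by (rule conjunct2)
  ultimately show ?thesis
    using assms(1) unfolding P_intersecting_def by metis
qed

lemma P_intersecting_no_halfspaces:
  assumes "H = {}" "P_intersecting d P B J" "J \<subseteq> I" "K \<subseteq> I"
  shows "P_intersecting d P B K"
  using assms by (simp add: P_intersecting_def inter_eq)

section \<open>A positive fraction\<close>

text \<open>These are the \<open>e\<close> that complete \<open>S\<close> to a \<open>P\<close>-intersecting set whose smallest translates, for
  halfspaces other than \<open>h0\<close>, all occur in \<open>S\<close>.\<close>
definition extensions :: "real vec set \<Rightarrow> 'i set \<Rightarrow> 'i set" where
  "extensions h0 S = {e \<in> I - S. P_intersecting d P B (insert e S) \<and>
     (\<forall>h\<in>H - {h0}. \<exists>s\<in>S. \<forall>i\<in>insert e S. T s h \<subseteq> T i h)}"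

text \<open>The \<open>k - 1\<close> halfspaces other than \<open>h0\<close> need at most \<open>k - 1\<close> members of \<open>J\<close> to realise their
  smallest translates. These are enlarged to exactly \<open>k - 1\<close> members, and \<open>e\<close> is the one left
  over.\<close>
lemma good_is_extension:
  assumes "h0 \<in> H" "J \<in> good"
  obtains S e where "S \<subseteq> I" "card S = card H - 1" "e \<in> extensions h0 S" "J = insert e S"
proof -
  have J: "J \<subseteq> I" "card J = card H" "P_intersecting d P B J"
    using assms(2) by (auto simp: good_def)
  have fin: "finite J"
    using J(1) finite_I finite_subset by blast
  have pos: "card H > 0"
    using assms(1) finite_H card_gt_0_iff by blast
  then have "J \<noteq> {}"
    using J(2) by auto
  then have "\<forall>h\<in>H. \<exists>i\<in>J. \<forall>j\<in>J. T i h \<subseteq> T j h"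
    using least_member[OF J(1)] by metis
  then obtain i where i: "\<And>h. h \<in> H \<Longrightarrow> i h \<in> J" "\<And>h j. h \<in> H \<Longrightarrow> j \<in> J \<Longrightarrow> T (i h) h \<subseteq> T j h"
    by metis
  have "card (i ` (H - {h0})) \<le> card H - 1"
    using card_image_le[of "H - {h0}" i] finite_H assms(1) by simp
  moreover have "i ` (H - {h0}) \<subseteq> J"
    using i(1) by auto
  ultimately obtain S where S: "i ` (H - {h0}) \<subseteq> S" "S \<subseteq> J" "card S = card H - 1"
    using exists_subset_between[of "i ` (H - {h0})" "card H - 1" J] J(2) fin by auto
  have "card (J - S) = 1"
    using S fin pos J(2) by (subst card_Diff_subset) (auto intro: finite_subset)
  then obtain e where "J - S = {e}"
    using card_1_singletonE by blast
  then have e: "J = insert e S" "e \<in> J - S"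
    using S(2) by auto
  have "e \<in> extensions h0 S"
  proof -
    have "e \<in> I - S" "P_intersecting d P B (insert e S)"
      using e J(1,3) by auto
    moreover have "\<exists>s\<in>S. \<forall>j\<in>insert e S. T s h \<subseteq> T j h" if "h \<in> H - {h0}" for h
      using that i(2)[of h] S(1) e(1) by (intro bexI[of _ "i h"]) auto
    ultimately show ?thesis
      by (simp add: extensions_def)
  qed
  then show ?thesis
    using that S(2,3) J(1) e(1) by blast
qed

text \<open>One \<open>S \<union> {e}\<close> dominates the whole union: for \<open>h \<noteq> h0\<close> the smallest translate in \<open>S\<close> lies below
  every extension, whichever \<open>e\<close> is used, so \<open>e\<close> can be chosen to serve \<open>h0\<close>.\<close>
lemma P_intersecting_extensions:
  assumes "h0 \<in> H" "S \<subseteq> I" "extensions h0 S \<noteq> {}"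
  shows "P_intersecting d P B (S \<union> extensions h0 S)"
proof -
  let ?F = "extensions h0 S"
  have sub: "S \<union> ?F \<subseteq> I"
    using assms(2) by (auto simp: extensions_def)
  obtain i where i: "i \<in> S \<union> ?F" "\<And>j. j \<in> S \<union> ?F \<Longrightarrow> T i h0 \<subseteq> T j h0"
    using least_member[OF sub _ assms(1)] assms(3) by auto
  obtain e where e: "e \<in> ?F" "i \<in> insert e S"
    using i(1) assms(3) by auto
  show ?thesis
  proof (rule P_intersecting_dominated[of "insert e S"])
    show "P_intersecting d P B (insert e S)"
      using e(1) by (simp add: extensions_def)
    show "\<exists>j\<in>insert e S. \<forall>l\<in>S \<union> ?F. T j h \<subseteq> T l h" if "h \<in> H" for h
    proof (cases "h = h0")
      case True
      have "\<forall>l\<in>S \<union> ?F. T i h \<subseteq> T l h"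
        using i(2) True by simp
      then show ?thesis
        using e(2) by (rule bexI)
    next
      case False
      have least: "\<exists>s\<in>S. \<forall>l\<in>insert f S. T s h \<subseteq> T l h" if "f \<in> ?F" for f
        using that False \<open>h \<in> H\<close> by (auto simp: extensions_def)
      obtain s where s: "s \<in> S" "\<forall>l\<in>insert e S. T s h \<subseteq> T l h"
        using least[OF e(1)] by blast
      have "T s h \<subseteq> T f h" if f: "f \<in> ?F" for f
      proof -
        obtain s' where s': "s' \<in> S" "\<forall>l\<in>insert f S. T s' h \<subseteq> T l h"
          using least[OF f] by blast
        have "T s h \<subseteq> T s' h"
          using s(2) s'(1) by simp
        also have "\<dots> \<subseteq> T f h"
          using s'(2) by simp
        finally show ?thesis .
      qed
      then have "\<forall>l\<in>S \<union> ?F. T s h \<subseteq> T l h"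
        using s(2) by (simp add: ball_Un)
      then show ?thesis
        using s(1) by (intro bexI[of _ s]) simp_all
    qed
    show "insert e S \<subseteq> I"
      using sub e(1) by blast
    show "insert e S \<noteq> {}" "S \<union> ?F \<noteq> {}"
      using assms(3) by auto
    show "S \<union> ?F \<subseteq> I"
      by (rule sub)
  qed
qed

text \<open>With \<open>k * (n choose k) = (n - k + 1) * (n choose (k - 1))\<close>, some \<open>S\<close> has at least
  \<open>\<alpha> * (n - k + 1) / k\<close> extensions. The \<open>k - 1\<close> members of \<open>S\<close> itself make up for the deficit
  \<open>\<alpha> * (k - 1) / k\<close> to \<open>\<alpha> * n / k\<close>, because \<open>\<alpha> \<le> 1 \<le> k\<close>.\<close>
lemma linear_size_subfamily:
  fixes \<alpha> :: real
  assumes "0 < \<alpha>" "\<alpha> \<le> 1" "0 < card H" "card H \<le> card I"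
    and many: "\<alpha> * real (card I choose card H) \<le> real (card good)"
  shows "\<exists>J\<subseteq>I. P_intersecting d P B J \<and> \<alpha> / real (card H) * real (card I) \<le> real (card J)"
proof -
  define n k where "n = card I" and "k = card H"
  have k: "0 < k" "k \<le> n"
    using assms(3,4) by (auto simp: n_def k_def)
  obtain h0 where h0: "h0 \<in> H"
    using assms(3) by (auto simp: card_gt_0_iff)
  define \<S> where "\<S> = {S. S \<subseteq> I \<and> card S = k - 1}"
  have fin\<S>: "finite \<S>" and card\<S>: "card \<S> = n choose (k - 1)"
    using finite_I by (auto simp: \<S>_def n_def n_subsets)
  have choose_pos: "0 < n choose (k - 1)"
    using k by (simp add: zero_less_binomial_iff)
  then have "\<S> \<noteq> {}"
    using card\<S> by auto
  let ?F = "extensions h0"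
  have finF: "finite (?F S)" for S
    using finite_I by (auto simp: extensions_def)
  define M where "M = Max ((\<lambda>S. card (?F S)) ` \<S>)"
  have "M \<in> (\<lambda>S. card (?F S)) ` \<S>"
    unfolding M_def by (rule Max_in) (use fin\<S> \<open>\<S> \<noteq> {}\<close> in auto)
  then obtain S where S: "S \<in> \<S>" "card (?F S) = M"
    by auto
  have M: "card (?F S') \<le> M" if "S' \<in> \<S>" for S'
    unfolding M_def using fin\<S> that by auto
  have "good \<subseteq> (\<Union>S\<in>\<S>. (\<lambda>e. insert e S) ` ?F S)"
  proof
    fix J assume J: "J \<in> good"
    obtain S' e where S': "S' \<subseteq> I" "card S' = card H - 1" "e \<in> ?F S'" "J = insert e S'"
      by (rule good_is_extension[OF h0 J])
    then have "S' \<in> \<S>"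
      by (simp add: \<S>_def k_def)
    then show "J \<in> (\<Union>S\<in>\<S>. (\<lambda>e. insert e S) ` ?F S)"
      using S'(3,4) by (intro UN_I[of S'] image_eqI[of _ _ e])
  qed
  then have "card good \<le> card (\<Union>S\<in>\<S>. (\<lambda>e. insert e S) ` ?F S)"
    by (intro card_mono) (use fin\<S> finF in auto)
  also have "\<dots> \<le> (\<Sum>S\<in>\<S>. card ((\<lambda>e. insert e S) ` ?F S))"
    by (rule card_UN_le[OF fin\<S>])
  also have "\<dots> \<le> (\<Sum>S\<in>\<S>. M)"
    by (intro sum_mono order.trans[OF card_image_le M]) (use finF in auto)
  finally have upper: "card good \<le> (n choose (k - 1)) * M"
    by (simp add: card\<S>)
  have "k * (n choose k) = (n - (k - 1)) * (n choose (k - 1))"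
    using binomial_absorb_comp[of n "k - 1"] binomial_absorption[of "k - 1" n] k
    by (metis Suc_diff_1 binomial_absorb_comp times_binomial_minus1_eq)
  then have "real k * real (n choose k) = real (n - (k - 1)) * real (n choose (k - 1))"
    by (metis of_nat_mult)
  moreover have "real k * (\<alpha> * real (n choose k)) \<le> real k * (real (n choose (k - 1)) * M)"
    using many upper k by (intro mult_left_mono) (auto simp: n_def k_def simp flip: of_nat_mult)
  ultimately have "(\<alpha> * real (n - (k - 1))) * real (n choose (k - 1)) \<le> (real k * M) * real (n choose (k - 1))"
    by (simp add: algebra_simps)
  then have lower: "\<alpha> * real (n - (k - 1)) \<le> real k * M"
    using choose_pos by simp
  moreover have "0 < \<alpha> * real (n - (k - 1))"
    using assms(1) k by simp
  ultimately have "0 < real k * M"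
    by linarith
  then have "?F S \<noteq> {}"
    using S(2) by (auto simp: zero_less_mult_iff)
  have "S \<subseteq> I" "card S = k - 1"
    using S(1) by (auto simp: \<S>_def)
  have "card (S \<union> ?F S) = (k - 1) + M"
    using card_Un_disjoint[of S "?F S"] finF S(2) \<open>S \<subseteq> I\<close> \<open>card S = k - 1\<close> finite_I
    by (auto simp: extensions_def intro: finite_subset)
  moreover have "\<alpha> * real n \<le> real k * real ((k - 1) + M)"
  proof -
    have "\<alpha> * real (k - 1) \<le> real k * real (k - 1)"
      using assms(2) k by (intro mult_right_mono) auto
    moreover have "\<alpha> * real n = \<alpha> * real (n - (k - 1)) + \<alpha> * real (k - 1)"
      using k by (simp add: algebra_simps of_nat_diff)
    ultimately show ?thesis
      using lower by (simp add: algebra_simps)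
  qed
  ultimately have "\<alpha> / real k * real n \<le> real (card (S \<union> ?F S))"
    using k by (simp add: field_simps)
  moreover have "S \<union> ?F S \<subseteq> I"
    using \<open>S \<subseteq> I\<close> by (auto simp: extensions_def)
  ultimately show ?thesis
    using P_intersecting_extensions[OF h0 \<open>S \<subseteq> I\<close> \<open>?F S \<noteq> {}\<close>] unfolding n_def k_def by blast
qed

section \<open>A fraction close to one\<close>

text \<open>Members that realise the smallest translates number at most \<open>k\<close>; padded to a \<open>k\<close>-tuple, they
  dominate the whole family.\<close>
lemma Helly:
  assumes "card H \<le> card I" "I \<noteq> {}" "H \<noteq> {}"
    and all: "card good = card I choose card H"
  shows "P_intersecting d P B I"
proof -
  have "good = {J. J \<subseteq> I \<and> card J = card H}"
    by (rule card_subset_eq) (use all finite_I in \<open>auto simp: good_def n_subsets\<close>)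
  then have all': "P_intersecting d P B J" if "J \<subseteq> I" "card J = card H" for J
    using that by (auto simp: good_def)
  have "\<forall>h\<in>H. \<exists>i\<in>I. \<forall>j\<in>I. T i h \<subseteq> T j h"
    using least_member[OF order_refl assms(2)] by metis
  then obtain i where i: "\<And>h. h \<in> H \<Longrightarrow> i h \<in> I" "\<And>h j. h \<in> H \<Longrightarrow> j \<in> I \<Longrightarrow> T (i h) h \<subseteq> T j h"
    by metis
  obtain J where J: "i ` H \<subseteq> J" "J \<subseteq> I" "card J = card H"
    using exists_subset_between[of "i ` H" "card H" I] i(1) assms(1) finite_I
      card_image_le[OF finite_H, of i] by blast
  show ?thesis
  proof (rule P_intersecting_dominated[of J])
    show "\<exists>j\<in>J. \<forall>l\<in>I. T j h \<subseteq> T l h" if "h \<in> H" for h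
      using i(2)[OF that] J(1) that by (intro bexI[of _ "i h"]) auto
    show "P_intersecting d P B J"
      using all' J(2,3) .
    show "J \<noteq> {}"
      using J(1) assms(3) by auto
  qed (use J(2) assms(2) in simp_all)
qed

text \<open>If the members that remain after discarding \<open>m\<close> for each halfspace are not
  \<open>P\<close>-intersecting, the transversals of the discarded classes are \<open>m ^ k\<close> distinct bad
  \<open>k\<close>-tuples.\<close>
lemma P_intersecting_or_few_good:
  assumes "H \<noteq> {}" "card H * m < card I"
  shows "(\<exists>J\<subseteq>I. P_intersecting d P B J \<and> card J + card H * m = card I) \<or>
    card good + m ^ card H \<le> card I choose card H"
proof -
  have chain: "T i h \<subseteq> T j h \<or> T j h \<subseteq> T i h" if "h \<in> H" "i \<in> I" "j \<in> I" for h i j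
    using translates_of_halfspace_chain[OF halfspace translate translate] that by blast
  obtain R where R: "\<forall>h\<in>H. R h \<subseteq> I \<and> card (R h) = m" "disjoint_family_on R H"
      "\<forall>h\<in>H. \<forall>r\<in>R h. \<forall>w\<in>I - \<Union>(R ` H). T r h \<subseteq> T w h"
    using disjoint_least_members[OF finite_H finite_I less_imp_le[OF assms(2)], of "\<lambda>h i. T i h"]
      chain by auto
  define K where "K = I - \<Union>(R ` H)"
  have finR: "finite (R h)" if "h \<in> H" for h
    using R(1) that finite_I finite_subset by blast
  have "card (\<Union>(R ` H)) = card H * m"
    using card_UN_disjoint'[OF R(2) finR finite_H] R(1) by simp
  moreover have "card K = card I - card (\<Union>(R ` H))"
    unfolding K_def by (rule card_Diff_subset) (use R(1) finR finite_H in auto)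
  ultimately have cardK: "card K + card H * m = card I"
    using assms(2) by simp
  then have "K \<noteq> {}"
    using assms(2) by (intro notI) simp
  have "K \<subseteq> I"
    by (auto simp: K_def)
  show ?thesis
  proof (cases "P_intersecting d P B K")
    case True
    then show ?thesis
      using cardK \<open>K \<subseteq> I\<close> by blast
  next
    case False
    let ?X = "Pi\<^sub>E H R"
    have memR: "f h \<in> R h" if "f \<in> ?X" "h \<in> H" for f h
      using that by (auto simp: PiE_def)
    have same: "g = h" if "x \<in> R g" "x \<in> R h" "g \<in> H" "h \<in> H" for g h x
      using R(2) that unfolding disjoint_family_on_def by blast
    have bad: "\<not> P_intersecting d P B (f ` H)" "f ` H \<subseteq> I" "card (f ` H) = card H" if "f \<in> ?X" for f
    proof -
      show sub: "f ` H \<subseteq> I"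
        using memR[OF that] R(1) by blast
      have "inj_on f H"
        using memR[OF that] same by (metis inj_onI)
      then show "card (f ` H) = card H"
        by (rule card_image)
      show "\<not> P_intersecting d P B (f ` H)"
      proof
        assume "P_intersecting d P B (f ` H)"
        then have "P_intersecting d P B K"
        proof (rule P_intersecting_dominated)
          show "\<exists>j\<in>f ` H. \<forall>i\<in>K. T j h \<subseteq> T i h" if "h \<in> H" for h
            using R(3) memR[OF \<open>f \<in> ?X\<close> that] that unfolding K_def by blast
        qed (use sub assms(1) \<open>K \<noteq> {}\<close> \<open>K \<subseteq> I\<close> in auto)
        then show False
          using False by blast
      qed
    qed
    \<comment> \<open>As the classes are disjoint, a transversal can be read off from its set of values.\<close>
    have "inj_on (\<lambda>f. f ` H) ?X"
    proof (rule inj_onI)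
      fix f g assume f: "f \<in> ?X" and g: "g \<in> ?X" and eq: "f ` H = g ` H"
      show "f = g"
      proof (rule PiE_ext[OF f g])
        fix h assume h: "h \<in> H"
        then obtain h' where h': "h' \<in> H" "f h = g h'"
          using eq by (metis imageE imageI)
        then have "h' = h"
          using same memR[OF f h] memR[OF g h'(1)] h by metis
        then show "f h = g h"
          using h' by simp
      qed
    qed
    then have "card ((\<lambda>f. f ` H) ` ?X) = card ?X"
      by (rule card_image)
    also have "\<dots> = m ^ card H"
      using R(1) finite_H by (simp add: card_PiE)
    finally have trans: "card ((\<lambda>f. f ` H) ` ?X) = m ^ card H" .
    have finX: "finite ?X"
      using finite_H finR by (intro finite_PiE) auto
    have "card good + m ^ card H = card (good \<union> (\<lambda>f. f ` H) ` ?X)"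
      unfolding trans[symmetric]
      by (rule card_Un_disjoint[symmetric]) (use finite_good finX bad(1) in \<open>auto simp: good_def\<close>)
    also have "\<dots> \<le> card {J. J \<subseteq> I \<and> card J = card H}"
      by (rule card_mono) (use finite_I bad in \<open>auto simp: good_def\<close>)
    also have "\<dots> = card I choose card H"
      by (simp add: n_subsets finite_I)
    finally show ?thesis
      by blast
  qed
qed

end

section \<open>The fractional Helly theorem\<close>

text \<open>This passes from arbitrary \<open>H\<close>-convex sets to a family with chosen translates.\<close>
lemma fractional_HellyI:
  assumes "\<And>d H P B T. H_convex_family d H P {..<n} B T \<Longrightarrow> card H = k \<Longrightarrow>
     \<alpha> * real (n choose k) \<le> real (card (H_convex_family.good d H P {..<n} B)) \<Longrightarrow>
     \<exists>J\<subseteq>{..<n}. P_intersecting d P B J \<and> \<beta> * real n \<le> real (card J)"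
  shows "fractional_Helly k \<alpha> \<beta> n"
  unfolding fractional_Helly_def
proof (intro allI impI)
  fix d H P B
  assume H: "finite H" "card H = k" "\<forall>h\<in>H. closed_halfspace d h" "monotone_property d H P"
    and B: "\<forall>i<n. H_convex d H (B i)"
    and many: "real (card {J. J \<subseteq> {..<n} \<and> card J = k \<and> P_intersecting d P B J})
      \<ge> \<alpha> * real (n choose k)"
  have "\<forall>i. \<exists>T. i < n \<longrightarrow> (\<forall>h\<in>H. is_translate d h (T h)) \<and> B i = inter d T H"
    using B unfolding H_convex_def by blast
  then obtain T where "\<And>i. i < n \<Longrightarrow> (\<forall>h\<in>H. is_translate d h (T i h)) \<and> B i = inter d (T i) H"
    by metis
  then interpret H_convex_family d H P "{..<n}" B T
    using H by unfold_locales auto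
  show "\<exists>J\<subseteq>{..<n}. P_intersecting d P B J \<and> \<beta> * real n \<le> real (card J)"
    by (rule assms[OF H_convex_family_axioms H(2)]) (use many H(2) in \<open>simp add: good_def\<close>)
qed

lemma fractional_Helly_antimono:
  assumes "fractional_Helly k \<alpha> \<beta> n" "\<alpha> \<le> \<alpha>'"
  shows "fractional_Helly k \<alpha>' \<beta> n"
proof -
  have "\<alpha> * real (n choose k) \<le> \<alpha>' * real (n choose k)"
    using assms(2) by (intro mult_right_mono) auto
  then show ?thesis
    unfolding fractional_Helly_def
    by (intro allI impI assms(1)[unfolded fractional_Helly_def, rule_format])
      (assumption | simp | linarith)+
qed

text \<open>Without halfspaces every member is the whole space, and so is the intersection of the empty
  family, which is the only \<open>0\<close>-tuple.\<close>
lemma fractional_Helly_no_halfspaces: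
  assumes "0 < \<alpha>"
  shows "fractional_Helly 0 \<alpha> 1 n"
proof (rule fractional_HellyI)
  fix d H P B T
  assume "H_convex_family d H P {..<n} B T" and H: "card H = 0"
    and many: "\<alpha> * real (n choose 0) \<le> real (card (H_convex_family.good d H P {..<n} B))"
  then interpret H_convex_family d H P "{..<n}" B T
    by simp
  have "good \<noteq> {}"
    using many assms by auto
  then obtain J where J: "J \<subseteq> {..<n}" "P_intersecting d P B J"
    by (auto simp: good_def)
  have "H = {}"
    using H finite_H by simp
  then have "P_intersecting d P B {..<n}"
    using J P_intersecting_no_halfspaces by blast
  then show "\<exists>J\<subseteq>{..<n}. P_intersecting d P B J \<and> 1 * real n \<le> real (card J)"
    by (intro exI[of _ "{..<n}"]) auto
qed

lemma fractional_Helly_linear: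
  assumes "0 < \<alpha>" "\<alpha> \<le> 1" "0 < k" "k \<le> n"
  shows "fractional_Helly k \<alpha> (\<alpha> / real k) n"
proof (rule fractional_HellyI)
  fix d H P B T
  assume "H_convex_family d H P {..<n} B T" and H: "card H = k"
    and many: "\<alpha> * real (n choose k) \<le> real (card (H_convex_family.good d H P {..<n} B))"
  then interpret H_convex_family d H P "{..<n}" B T
    by simp
  show "\<exists>J\<subseteq>{..<n}. P_intersecting d P B J \<and> \<alpha> / real k * real n \<le> real (card J)"
    using linear_size_subfamily[of \<alpha>] assms H many by simp
qed

lemma fractional_Helly_more_than_all:
  assumes "1 < \<alpha>" "k \<le> n"
  shows "fractional_Helly k \<alpha> \<beta> n"
proof (rule fractional_HellyI)
  fix d H P B T
  assume "H_convex_family d H P {..<n} B T" and H: "card H = k"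
    and many: "\<alpha> * real (n choose k) \<le> real (card (H_convex_family.good d H P {..<n} B))"
  then interpret H_convex_family d H P "{..<n}" B T
    by simp
  have "0 < n choose k"
    using assms(2) by (simp add: zero_less_binomial_iff)
  then have "1 * real (n choose k) < \<alpha> * real (n choose k)"
    using assms(1) by (intro mult_strict_right_mono) auto
  then have False
    using many good_le_choose H by simp
  then show "\<exists>J\<subseteq>{..<n}. P_intersecting d P B J \<and> \<beta> * real n \<le> real (card J)" ..
qed

lemma fractional_Helly_all:
  assumes "0 < k" "k \<le> n"
  shows "fractional_Helly k 1 1 n"
proof (rule fractional_HellyI)
  fix d H P B T
  assume "H_convex_family d H P {..<n} B T" and H: "card H = k"
    and many: "1 * real (n choose k) \<le> real (card (H_convex_family.good d H P {..<n} B))"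
  then interpret H_convex_family d H P "{..<n}" B T
    by simp
  have "card good = card {..<n} choose card H"
    using good_le_choose many H by simp
  moreover have "{..<n} \<noteq> {}" "H \<noteq> {}"
    using assms H by (auto simp: lessThan_empty_iff)
  ultimately have "P_intersecting d P B {..<n}"
    using Helly assms(2) H by simp
  then show "\<exists>J\<subseteq>{..<n}. P_intersecting d P B J \<and> 1 * real n \<le> real (card J)"
    by (intro exI[of _ "{..<n}"]) auto
qed

text \<open>If \<open>1 - k * \<gamma> \<le> 0\<close>, the size bound is void and any single good tuple is a witness. Otherwise
  \<open>k * m < n\<close>, so some members survive the discarding of \<open>m = \<lfloor>\<gamma> n\<rfloor>\<close> for each halfspace.\<close>
lemma fractional_Helly_discarding:
  fixes \<alpha> \<gamma> :: real
  assumes "0 < \<alpha>" "0 < k" "k \<le> n" "0 \<le> \<gamma>"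
    and discard: "(1 - \<alpha>) * real n ^ k < real (nat \<lfloor>\<gamma> * real n\<rfloor>) ^ k"
    and \<alpha>1: "\<alpha> \<le> 1"
  shows "fractional_Helly k \<alpha> (1 - real k * \<gamma>) n"
proof (rule fractional_HellyI)
  fix d H P B T
  assume "H_convex_family d H P {..<n} B T" and H: "card H = k"
    and many: "\<alpha> * real (n choose k) \<le> real (card (H_convex_family.good d H P {..<n} B))"
  then interpret H_convex_family d H P "{..<n}" B T
    by simp
  let ?\<beta> = "1 - real k * \<gamma>"
  show "\<exists>J\<subseteq>{..<n}. P_intersecting d P B J \<and> ?\<beta> * real n \<le> real (card J)"
  proof (cases "?\<beta> \<le> 0")
    case True
    have "0 < n choose k"
      using assms(3) by (simp add: zero_less_binomial_iff)
    then have "0 < \<alpha> * real (n choose k)"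
      using assms(1) by simp
    then have "good \<noteq> {}"
      using many by auto
    then obtain J where "J \<subseteq> {..<n}" "P_intersecting d P B J"
      by (auto simp: good_def)
    moreover have "?\<beta> * real n \<le> real (card J)"
      using True by (meson mult_nonpos_nonneg of_nat_0_le_iff order_trans)
    ultimately show ?thesis
      by blast
  next
    case False
    define m where "m = nat \<lfloor>\<gamma> * real n\<rfloor>"
    have m: "real m \<le> \<gamma> * real n"
      unfolding m_def using assms(4) by simp
    then have km: "real k * real m \<le> (real k * \<gamma>) * real n"
      using mult_left_mono[OF m, of "real k"] by (simp add: mult.assoc)
    also have "\<dots> < 1 * real n"
      using False assms(2,3) by (intro mult_strict_right_mono) auto
    finally have "k * m < n"
      by (simp flip: of_nat_mult)
    moreover have "\<not> card good + m ^ k \<le> n choose k"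
    proof
      assume "card good + m ^ k \<le> n choose k"
      then have "real (card good) + real m ^ k \<le> real (n choose k)"
        by (metis of_nat_add of_nat_le_iff of_nat_power)
      then have "real m ^ k \<le> (1 - \<alpha>) * real (n choose k)"
        using many by (simp add: algebra_simps)
      also have "\<dots> \<le> (1 - \<alpha>) * real n ^ k"
        using \<alpha>1 binomial_le_pow[OF assms(3)] by (intro mult_left_mono) (auto simp flip: of_nat_power)
      finally show False
        using discard by (simp add: m_def)
    qed
    moreover have "H \<noteq> {}"
      using H assms(2) by auto
    ultimately obtain J where J: "J \<subseteq> {..<n}" "P_intersecting d P B J" "card J + k * m = n"
      using P_intersecting_or_few_good[of m] H by auto
    have "real (card J) + real k * real m = real n"
      using J(3) by (metis of_nat_add of_nat_mult)
    then have "?\<beta> * real n \<le> real (card J)"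
      using km by (simp add: algebra_simps)
    then show ?thesis
      using J by blast
  qed
qed

text \<open>After division by \<open>n ^ k\<close> the right side is at least \<open>(\<gamma> - 1 / n) ^ k\<close>, which tends to
  \<open>\<gamma> ^ k > \<gamma> ^ (k + 1)\<close>. This strict gap absorbs the rounding.\<close>
lemma eventually_discard:
  fixes \<gamma> :: real
  assumes "0 < \<gamma>" "\<gamma> < 1"
  shows "\<forall>\<^sub>F n in sequentially. \<gamma> ^ (k + 1) * real n ^ k < real (nat \<lfloor>\<gamma> * real n\<rfloor>) ^ k"
proof -
  have "(\<lambda>n. (\<gamma> - 1 / real n) ^ k) \<longlonglongrightarrow> (\<gamma> - 0) ^ k"
    by (intro tendsto_intros lim_1_over_n)
  moreover have "\<gamma> ^ (k + 1) < (\<gamma> - 0) ^ k"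
    using assms by simp
  ultimately have "\<forall>\<^sub>F n in sequentially. \<gamma> ^ (k + 1) < (\<gamma> - 1 / real n) ^ k"
    by (rule order_tendstoD)
  moreover have "\<forall>\<^sub>F n in sequentially. n \<ge> nat \<lceil>1 / \<gamma>\<rceil> + 1"
    by (rule eventually_ge_at_top)
  ultimately show ?thesis
  proof eventually_elim
    case (elim n)
    \<comment> \<open>The bound on \<open>n\<close> makes \<open>\<gamma> * n - 1\<close> nonnegative, so that taking powers keeps the order.\<close>
    have n: "0 < real n" "1 / \<gamma> \<le> real n"
      using elim(2) by linarith+
    have "0 \<le> \<gamma> * real n - 1"
      using n assms by (simp add: field_simps)
    have "\<gamma> ^ (k + 1) * real n ^ k < (\<gamma> - 1 / real n) ^ k * real n ^ k"
      using elim(1) n by (intro mult_strict_right_mono) auto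
    also have "\<dots> = (\<gamma> * real n - 1) ^ k"
      using n by (simp add: field_simps flip: power_mult_distrib)
    also have "\<dots> \<le> real (nat \<lfloor>\<gamma> * real n\<rfloor>) ^ k"
      using \<open>0 \<le> \<gamma> * real n - 1\<close> by (intro power_mono) linarith+
    finally show ?case .
  qed
qed

theorem theorem2p2:
  fixes k :: nat and \<alpha> :: real
  assumes "\<alpha> > 0"
  shows "(\<exists>\<beta>>0. \<forall>n\<ge>k. fractional_Helly k \<alpha> \<beta> n) \<and>
         (\<exists>N. \<forall>n\<ge>N. fractional_Helly k \<alpha> (1 - real k * (1 - \<alpha>) powr (1 / (real k + 1))) n)"
proof (cases "k = 0")
  case True
  then show ?thesis
    using fractional_Helly_no_halfspaces[OF assms] by (auto intro: exI[of _ 1])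
next
  case False
  \<comment> \<open>The linear bound is stated for \<open>\<alpha> \<le> 1\<close>; a larger \<open>\<alpha>\<close> only strengthens the hypothesis.\<close>
  let ?\<alpha> = "min \<alpha> 1"
  have "fractional_Helly k \<alpha> (?\<alpha> / real k) n" if "n \<ge> k" for n
    by (rule fractional_Helly_antimono[OF fractional_Helly_linear]) (use that False assms in auto)
  then have "\<exists>\<beta>>0. \<forall>n\<ge>k. fractional_Helly k \<alpha> \<beta> n"
    using False assms by (intro exI[of _ "?\<alpha> / real k"]) auto
  moreover
  define \<gamma> where "\<gamma> = (1 - \<alpha>) powr (1 / (real k + 1))"
  consider "\<alpha> > 1" | "\<alpha> = 1" | "\<alpha> < 1"
    by linarith
  then have "\<exists>N. \<forall>n\<ge>N. fractional_Helly k \<alpha> (1 - real k * \<gamma>) n"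
  proof cases
    case 1
    then show ?thesis
      using fractional_Helly_more_than_all by blast
  next
    case 2
    then have "\<gamma> = 0"
      by (simp add: \<gamma>_def)
    then show ?thesis
      using fractional_Helly_all 2 False by (intro exI[of _ k]) auto
  next
    case 3
    have pow: "\<gamma> ^ (k + 1) = 1 - \<alpha>"
    proof -
      have "\<gamma> ^ (k + 1) = \<gamma> powr real (k + 1)"
        using 3 by (intro powr_realpow[symmetric]) (simp add: \<gamma>_def)
      also have "\<dots> = (1 - \<alpha>) powr 1"
        unfolding \<gamma>_def powr_powr by (simp add: add.commute)
      finally show ?thesis
        using 3 by simp
    qed
    have \<gamma>: "0 < \<gamma>" "\<gamma> < 1"
    proof -
      show "0 < \<gamma>"
        using 3 by (simp add: \<gamma>_def)
      show "\<gamma> < 1"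
        using pow assms by (metis diff_less_eq less_add_same_cancel1 linorder_not_less one_le_power)
    qed
    have "\<forall>\<^sub>F n in sequentially. fractional_Helly k \<alpha> (1 - real k * \<gamma>) n"
      using eventually_discard[OF \<gamma>, of k] eventually_ge_at_top[of k]
    proof eventually_elim
      case (elim n)
      then show ?case
        unfolding pow using False assms \<gamma> 3 by (intro fractional_Helly_discarding) auto
    qed
    then show ?thesis
      by (simp add: eventually_sequentially)
  qed
  ultimately show ?thesis
    unfolding \<gamma>_def by blast
qed

end
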